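(* Let $n$ be a positive integer, let $\mathbb{F}$ be a field, and let $\mathcal{V}\subseteq\mathbb{F}^n$ be a finite subset of the affine space $\mathbb{F}^n$. Let $k\geq 0$ be any non-negative integer such that $$\binom{n+k}{n}<|\mathcal{V}|.$$ Then $$k<AC(\mathcal{V}),$$ i.e. there exists a vector $\mathbf{v}\in\mathcal{V}$ such that $k<AC(\mathcal{V},\mathbf{v})$.
   Context: For a finite set of points $\mathcal{V}\subseteq\mathbb{F}^n$ and $\mathbf{v}\in\mathcal{V}$, a finite set of affine hyperplanes $\{H_1,\ldots,H_m\}$ of $\mathbb{F}^n$ is an almost cover of $\mathcal{V}$ and $\mathbf{v}$ if the union $\bigcup_{j=1}^m H_j$ contains $\mathcal{V}\setminus\{\mathbf{v}\}$ but does not contain $\mathbf{v}$. $AC(\mathcal{V},\mathbf{v})$ denotes the minimum size (number of hyperplanes) of an almost cover of $\mathcal{V}$ and $\mathbf{v}$, and $AC(\mathcal{V}):=\max_{\mathbf{v}\in\mathcal{V}}AC(\mathcal{V},\mathbf{v})$. *)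

theory Defs
  imports "HOL-Analysis.Analysis"
begin

text \<open>
  The affine space \<open>F^n\<close> is \<^typ>\<open>'a::field ^ 'n::finite\<close>, with \<open>n = CARD('n)\<close>.
\<close>

definition affine_hyperplane :: "('a::field ^ 'n) set \<Rightarrow> bool" where
  "affine_hyperplane H \<longleftrightarrow> (\<exists>a b. a \<noteq> 0 \<and> H = {x. (\<Sum>i\<in>UNIV. a $ i * x $ i) = b})"

definition almost_cover ::
    "('a::field ^ 'n) set \<Rightarrow> 'a ^ 'n \<Rightarrow> ('a ^ 'n) set set \<Rightarrow> bool" where
  "almost_cover V v HS \<longleftrightarrow>
     finite HS \<and> (\<forall>H\<in>HS. affine_hyperplane H) \<and> V - {v} \<subseteq> \<Union>HS \<and> v \<notin> \<Union>HS"

definition AC_at :: "('a::field ^ 'n) set \<Rightarrow> 'a ^ 'n \<Rightarrow> nat" where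
  "AC_at V v = (LEAST m. \<exists>HS. almost_cover V v HS \<and> card HS = m)"

text \<open>Meaningful for finite nonempty \<open>V\<close> only, as \<^const>\<open>Max\<close> is unspecified on other sets.\<close>

definition AC :: "('a::field ^ 'n) set \<Rightarrow> nat" where
  "AC V = Max (AC_at V ` V)"

text \<open>For finite \<open>V\<close> an almost cover always exists, so the minimum in \<^const>\<open>AC_at\<close> is attained.\<close>

lemma almost_cover_exists:
  fixes V :: "('a::field ^ 'n) set"
  assumes "finite V"
  shows "\<exists>HS. almost_cover V v HS"
proof -
  have "\<exists>H. affine_hyperplane H \<and> w \<in> H \<and> v \<notin> H" if "w \<in> V - {v}" for w
  proof -
    from that obtain i where i: "w $ i \<noteq> v $ i"
      by (auto simp: vec_eq_iff)
    have eq: "(\<Sum>j\<in>UNIV. axis i 1 $ j * x $ j) = x $ i" for x :: "'a ^ 'n"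
    proof -
      have "(\<Sum>j\<in>UNIV. axis i 1 $ j * x $ j) = (\<Sum>j\<in>UNIV. if j = i then x $ j else 0)"
        by (rule sum.cong) (auto simp: axis_def)
      then show ?thesis by simp
    qed
    have "(axis i 1 :: 'a ^ 'n) \<noteq> 0"
      by (simp add: axis_eq_0_iff)
    then have "affine_hyperplane {x :: 'a ^ 'n. x $ i = w $ i}"
      unfolding affine_hyperplane_def
      by (intro exI[of _ "axis i 1"] exI[of _ "w $ i"]) (simp add: eq)
    then show ?thesis using i by (intro exI[of _ "{x. x $ i = w $ i}"]) auto
  qed
  then obtain h where h: "\<And>w. w \<in> V - {v} \<Longrightarrow> affine_hyperplane (h w) \<and> w \<in> h w \<and> v \<notin> h w"
    by metis
  have "almost_cover V v (h ` (V - {v}))"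
    unfolding almost_cover_def using h assms by auto
  then show ?thesis ..
qed

lemma AC_at_attained:
  fixes V :: "('a::field ^ 'n) set"
  assumes "finite V"
  shows "\<exists>HS. almost_cover V v HS \<and> card HS = AC_at V v"
  unfolding AC_at_def
  by (rule LeastI_ex) (use almost_cover_exists[OF assms] in blast)

end

(*
  Polynomial method.  The product of the equations of the hyperplanes in an almost cover of V
  and v is a polynomial of degree the number of hyperplanes which vanishes on V - {v} but not
  at v.  If every point v of V had an almost cover by at most k hyperplanes, these polynomials
  would be linearly independent functions in the space of polynomials of degree at most k, whose
  dimension is at most (n + k) choose n.
*)
theory Submission
  imports Defs "HOL-Library.Function_Algebras"
begin

text \<open>Together with pointwise addition this makes the functions into \<open>'a\<close> a
  vector space over the arbitrary field \<open>'a\<close>, so that span and independence are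
  available.\<close>

definition pointwise_scale :: "'a::field \<Rightarrow> ('b \<Rightarrow> 'a) \<Rightarrow> 'b \<Rightarrow> 'a" where
  "pointwise_scale c f = (\<lambda>x. c * f x)"

interpretation pointwise: vector_space "pointwise_scale :: 'a::field \<Rightarrow> ('b \<Rightarrow> 'a) \<Rightarrow> 'b \<Rightarrow> 'a"
  by standard (auto simp: pointwise_scale_def algebra_simps)

lemma sum_fun_apply: "(\<Sum>i\<in>A. f i) x = (\<Sum>i\<in>A. f i x :: 'a::comm_monoid_add)"
  by (induction A rule: infinite_finite_induct) auto

text \<open>Evaluating a vanishing linear combination of the \<open>f v\<close> at a point of
  \<open>V\<close> isolates a single coefficient. Hence the \<open>f v\<close> are independent, and
  a set spanned by \<open>T\<close> cannot contain more than \<open>card T\<close> independent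
  elements.\<close>

lemma card_le_of_separating_functions:
  fixes f :: "'b \<Rightarrow> 'b \<Rightarrow> 'a::field"
  assumes "finite V" "finite T"
    and span: "\<And>v. v \<in> V \<Longrightarrow> f v \<in> pointwise.span T"
    and diag: "\<And>v. v \<in> V \<Longrightarrow> f v v \<noteq> 0"
    and off_diag: "\<And>v w. v \<in> V \<Longrightarrow> w \<in> V \<Longrightarrow> w \<noteq> v \<Longrightarrow> f v w = 0"
  shows "card V \<le> card T"
proof -
  have inj: "inj_on f V"
    using diag off_diag by (metis inj_onI)
  have "pointwise.independent (f ` V)"
  proof (rule pointwise.independent_if_scalars_zero)
    fix c g
    assume sum: "(\<Sum>g\<in>f ` V. pointwise_scale (c g) g) = 0" and "g \<in> f ` V"
    then obtain v where v: "v \<in> V" "g = f v"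
      by blast
    \<comment> \<open>Evaluation at \<open>v\<close> kills every term with
      \<open>w \<noteq> v\<close>.\<close>
    have "0 = (\<Sum>w\<in>V. pointwise_scale (c (f w)) (f w)) v"
      using sum by (simp add: sum.reindex[OF inj])
    also have "\<dots> = (\<Sum>w\<in>V. if w = v then c (f v) * f v v else 0)"
      unfolding sum_fun_apply pointwise_scale_def
      by (rule sum.cong) (use off_diag v in auto)
    also have "\<dots> = c g * f v v"
      using \<open>finite V\<close> v by simp
    finally show "c g = 0"
      using diag v by simp
  qed (use \<open>finite V\<close> in simp)
  then have "card (f ` V) \<le> card T"
    using pointwise.independent_span_bound \<open>finite T\<close> span by (metis image_subsetI)
  then show ?thesis
    by (simp add: card_image[OF inj])
qed

text \<open>
  Polynomials of degree at most \<open>k\<close> are represented through homogenization: \<open>None\<close> stands for the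
  homogenizing variable, evaluated at 1, so that they are spanned by the monomials of degree
  exactly \<open>k\<close> in \<open>n + 1\<close> variables.
\<close>

definition hcoord :: "'n option \<Rightarrow> 'a::field ^ 'n \<Rightarrow> 'a" where
  "hcoord j x = (case j of None \<Rightarrow> 1 | Some i \<Rightarrow> x $ i)"

definition monomials :: "nat \<Rightarrow> ('a::field ^ 'n::finite \<Rightarrow> 'a) set" where
  "monomials k = (\<lambda>m x. \<Prod>j\<in>#m. hcoord j x) ` multisets_of_size UNIV k"

abbreviation polys :: "nat \<Rightarrow> ('a::field ^ 'n::finite \<Rightarrow> 'a) set" where
  "polys k \<equiv> pointwise.span (monomials k)"

lemma finite_monomials: "finite (monomials k)"
  by (simp add: monomials_def finite_multisets_of_size)

text \<open>Multisets of size \<open>k\<close> over \<open>n + 1\<close> variables are counted by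
  stars and bars. Only an inequality holds, since over a finite field different multisets can give
  the same function.\<close>

lemma card_monomials_le:
  "card (monomials k :: ('a::field ^ 'n::finite \<Rightarrow> 'a) set) \<le> (CARD('n) + k) choose CARD('n)"
proof -
  have "card (monomials k :: ('a ^ 'n \<Rightarrow> 'a) set) \<le> card (multisets_of_size (UNIV :: 'n option set) k)"
    unfolding monomials_def by (intro card_image_le finite_multisets_of_size) simp
  also have "\<dots> = (CARD('n) + k) choose k"
    by (simp add: card_multisets_of_size card_UNIV_option)
  also have "\<dots> = (CARD('n) + k) choose CARD('n)"
    by (subst binomial_symmetric) auto
  finally show ?thesis .
qed

text \<open>Multiplication by a coordinate adds one element to the multiset of a monomial; linearity
  extends this to the span.\<close>

lemma hcoord_mult_in_polys:
  assumes "f \<in> polys k"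
  shows "(\<lambda>x. hcoord j x * f x) \<in> polys (Suc k)"
  using assms
proof (induction rule: pointwise.span_induct_alt)
  case base
  have "(\<lambda>x. hcoord j x * 0 x) = 0"
    by (simp add: fun_eq_iff)
  then show ?case
    by (metis pointwise.span_zero)
next
  case (step c f g)
  from step(1) obtain m where m: "size m = k" "f = (\<lambda>x. \<Prod>i\<in>#m. hcoord i x)"
    by (auto simp: monomials_def multisets_of_size_def)
  have "(\<lambda>x. hcoord j x * f x) = (\<lambda>x. \<Prod>i\<in>#add_mset j m. hcoord i x)"
    by (simp add: m)
  also have "\<dots> \<in> monomials (Suc k)"
    unfolding monomials_def by (rule imageI) (simp add: multisets_of_size_def m)
  finally have "pointwise_scale c (\<lambda>x. hcoord j x * f x) + (\<lambda>x. hcoord j x * g x) \<in> polys (Suc k)"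
    by (rule pointwise.span_add[OF pointwise.span_scale[OF pointwise.span_base] step(2)])
  also have "pointwise_scale c (\<lambda>x. hcoord j x * f x) + (\<lambda>x. hcoord j x * g x) =
      (\<lambda>x. hcoord j x * (pointwise_scale c f + g) x)"
    by (simp add: fun_eq_iff pointwise_scale_def algebra_simps)
  finally show ?case .
qed

text \<open>Multiplying by the homogenizing variable, which evaluates to 1, raises the formal degree
  without changing the function.\<close>

lemma polys_mono:
  assumes "k \<le> l"
  shows "polys k \<subseteq> (polys l :: ('a::field ^ 'n::finite \<Rightarrow> 'a) set)"
proof (rule lift_Suc_mono_le[OF _ assms])
  show "polys k \<subseteq> (polys (Suc k) :: ('a ^ 'n \<Rightarrow> 'a) set)" for k
    using hcoord_mult_in_polys[where j = None] by (auto simp: hcoord_def)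
qed

lemma affine_form_mult_in_polys:
  assumes "f \<in> polys k"
  shows "(\<lambda>x. ((\<Sum>i\<in>UNIV. a $ i * x $ i) - b) * f x) \<in> polys (Suc k)"
proof -
  \<comment> \<open>The constant \<open>b\<close> becomes \<open>b\<close> times the homogenizing
    variable, so every summand is a scaled product of \<open>f\<close> with a coordinate.\<close>
  have "(\<lambda>x. ((\<Sum>i\<in>UNIV. a $ i * x $ i) - b) * f x) =
      (\<Sum>i\<in>UNIV. pointwise_scale (a $ i) (\<lambda>x. hcoord (Some i) x * f x))
        - pointwise_scale b (\<lambda>x. hcoord None x * f x)"
    by (simp add: fun_eq_iff fun_diff_def sum_fun_apply pointwise_scale_def hcoord_def
        sum_distrib_left algebra_simps)
  also have "\<dots> \<in> polys (Suc k)"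
    by (intro pointwise.span_diff pointwise.span_sum pointwise.span_scale
        hcoord_mult_in_polys assms)
  finally show ?thesis .
qed

text \<open>The witness is the product of one affine equation per hyperplane; as a field has no zero
  divisors, it vanishes exactly on the union.\<close>

lemma hyperplanes_polynomial:
  fixes HS :: "('a::field ^ 'n::finite) set set"
  assumes "finite HS" "\<And>H. H \<in> HS \<Longrightarrow> affine_hyperplane H"
  shows "\<exists>f\<in>polys (card HS). \<forall>x. f x = 0 \<longleftrightarrow> x \<in> \<Union>HS"
  using assms
proof (induction HS rule: finite_induct)
  case empty
  \<comment> \<open>The empty product is the monomial of the empty multiset.\<close>
  have "(\<lambda>x. 1) \<in> (monomials 0 :: ('a ^ 'n \<Rightarrow> 'a) set)"
    by (simp add: monomials_def)
  then show ?case
    by (intro bexI[of _ "\<lambda>x. 1"]) (auto intro: pointwise.span_base)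
next
  case (insert H HS)
  then obtain f where f: "f \<in> polys (card HS)" "\<And>x. f x = 0 \<longleftrightarrow> x \<in> \<Union>HS"
    by auto
  obtain a b where H: "H = {x. (\<Sum>i\<in>UNIV. a $ i * x $ i) = b}"
    using insert.prems unfolding affine_hyperplane_def by blast
  show ?case
    using affine_form_mult_in_polys[OF f(1), of a b] insert.hyps
    by (intro bexI[of _ "\<lambda>x. ((\<Sum>i\<in>UNIV. a $ i * x $ i) - b) * f x"]) (auto simp: f(2) H)
qed

theorem theorem1p5:
  fixes V :: "('a::field ^ 'n::finite) set" and k :: nat
  assumes "finite V"
    and "(CARD('n) + k) choose CARD('n) < card V"
  shows "k < AC V \<and> (\<exists>v\<in>V. k < AC_at V v)"
proof -
  have "\<exists>v\<in>V. k < AC_at V v"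
  proof (rule ccontr)
    assume small: "\<not> (\<exists>v\<in>V. k < AC_at V v)"
    have "\<exists>f\<in>polys k. f v \<noteq> 0 \<and> (\<forall>w\<in>V - {v}. f w = 0)" if v: "v \<in> V" for v
    proof -
      obtain HS where HS: "almost_cover V v HS" "card HS = AC_at V v"
        using AC_at_attained[OF \<open>finite V\<close>] by blast
      then obtain f where f: "f \<in> polys (card HS)" "\<And>x. f x = 0 \<longleftrightarrow> x \<in> \<Union>HS"
        using hyperplanes_polynomial[of HS] by (auto simp: almost_cover_def)
      \<comment> \<open>A minimum cover may have fewer than \<open>k\<close> hyperplanes;
        \<open>polys_mono\<close> puts all the polynomials into the same space
        \<open>polys k\<close>.\<close>
      have "card HS \<le> k"
        using small v HS(2) by auto
      then have "f \<in> polys k"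
        using polys_mono f(1) by blast
      moreover have "f v \<noteq> 0" "\<forall>w\<in>V - {v}. f w = 0"
        using HS(1) unfolding almost_cover_def f(2) by blast+
      ultimately show ?thesis
        by blast
    qed
    then obtain f where "\<And>v. v \<in> V \<Longrightarrow> f v \<in> polys k"
      and "\<And>v. v \<in> V \<Longrightarrow> f v v \<noteq> 0"
      and "\<And>v w. v \<in> V \<Longrightarrow> w \<in> V \<Longrightarrow> w \<noteq> v \<Longrightarrow> f v w = 0"
      by (metis Diff_iff singletonD)
    then have "card V \<le> card (monomials k :: ('a ^ 'n \<Rightarrow> 'a) set)"
      by (rule card_le_of_separating_functions[OF \<open>finite V\<close> finite_monomials])
    with card_monomials_le[of k, where ?'a = 'a and ?'n = 'n] assms(2) show False
      by linarith
  qed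
  \<comment> \<open>As \<open>V\<close> is finite, \<open>Max\<close> bounds every value, so the
    point found above also yields \<open>k < AC V\<close>.\<close>
  moreover have "AC_at V v \<le> AC V" if "v \<in> V" for v
    unfolding AC_def using that \<open>finite V\<close> by (intro Max_ge) auto
  ultimately show ?thesis
    by (meson less_le_trans)
qed

end
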